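(* Let $K$ be a field and let $I\subset S=K[x_1,x_2]$ be a monomial ideal minimally generated by $m$ monomials. If $\operatorname{slength}(I)=m$, then $I$ has linear quotients.
   Context: Let $S=K[x_1,\ldots,x_n]$ (here $n=2$) and let $M$ be a finitely generated $\mathbb Z^n$-graded $S$-module. A Stanley decomposition of $M$ is a finite direct sum of $K$-vector spaces $\mathcal D: M=\bigoplus_{i=1}^r m_iK[Z_i]$, where each $m_i\in M$ is homogeneous, $Z_i\subset\{x_1,\ldots,x_n\}$, and $m_iK[Z_i]$ is a free $K[Z_i]$-module. Its length is $\operatorname{slength}(\mathcal D)=r$, and the Stanley length of $M$ is $\operatorname{slength}(M)=\min\{\operatorname{slength}(\mathcal D):\mathcal D\text{ is a Stanley decomposition of }M\}$. A monomial ideal $I$ has linear quotients if its minimal monomial generators can be ordered as $u_1,u_2,\ldots,u_m$ so that for every $2\leq j\leq m$ the ideal $(u_1,\ldots,u_{j-1}):u_j$ is generated by a subset of the variables. *)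

theory Defs
  imports
    "HOL-Library.Poly_Mapping"
    "HOL-Library.Numeral_Type"
    "HOL-Library.FuncSet"
    "HOL-Library.Extended_Nat"
begin

text \<open>
  The polynomial ring \<open>K[x\<^sub>v | v \<in> 'v]\<close>: finitely supported maps from exponent vectors to
  coefficients, with the convolution product of \<open>Poly_Mapping\<close>. The ring \<open>K[x\<^sub>1, x\<^sub>2]\<close> is
  the case of the two-element index type \<open>2\<close>.
\<close>

type_synonym ('v, 'k) mpoly = "('v \<Rightarrow>\<^sub>0 nat) \<Rightarrow>\<^sub>0 'k"

definition monomial :: "('v \<Rightarrow>\<^sub>0 nat) \<Rightarrow> ('v, 'k::field) mpoly" where
  "monomial t = Poly_Mapping.single t 1"

definition var :: "'v \<Rightarrow> ('v, 'k::field) mpoly" where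
  "var v = monomial (Poly_Mapping.single v 1)"

definition polys_in :: "'v set \<Rightarrow> ('v, 'k::field) mpoly set" where
  "polys_in Z = {f. \<forall>t\<in>Poly_Mapping.keys f. Poly_Mapping.keys t \<subseteq> Z}"


subsection \<open>Monomial ideals\<close>

text \<open>A commutative ring is a module over itself; its submodules are the ideals.\<close>

global_interpretation ideal: module "(*) :: 'a::comm_ring_1 \<Rightarrow> 'a \<Rightarrow> 'a"
  defines ideal_generated_by = ideal.span
  by unfold_locales (simp_all add: algebra_simps)

definition monomial_ideal :: "('v, 'k::field) mpoly set \<Rightarrow> bool" where
  "monomial_ideal I \<longleftrightarrow> (\<exists>G \<subseteq> range monomial. I = ideal_generated_by G)"

definition minimal_monomial_generators ::
    "('v, 'k::field) mpoly set \<Rightarrow> ('v, 'k) mpoly set \<Rightarrow> bool" where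
  "minimal_monomial_generators I G \<longleftrightarrow>
     G \<subseteq> range monomial \<and> ideal_generated_by G = I \<and>
     (\<forall>H. H \<subset> G \<longrightarrow> ideal_generated_by H \<noteq> I)"

definition colon :: "'a::comm_ring_1 set \<Rightarrow> 'a \<Rightarrow> 'a set" where
  "colon J u = {f. f * u \<in> J}"

text \<open>
  List positions count from \<open>0\<close>, so \<open>us ! j\<close> is \<open>u\<^bsub>j+1\<^esub>\<close> and \<open>take j us\<close> lists all of its
  predecessors.
\<close>

definition linear_quotients :: "('v, 'k::field) mpoly set \<Rightarrow> bool" where
  "linear_quotients I \<longleftrightarrow>
     (\<exists>us. distinct us \<and> minimal_monomial_generators I (set us) \<and>
           (\<forall>j. 1 \<le> j \<and> j < length us \<longrightarrow>
                (\<exists>Z. colon (ideal_generated_by (set (take j us))) (us ! j) =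
                     ideal_generated_by (var ` Z))))"


subsection \<open>Stanley decompositions of graded ideals\<close>

text \<open>The grading is by \<open>\<int>\<^sup>n\<close>; the components of degree outside \<open>\<nat>\<^sup>n\<close> are zero.\<close>

definition graded_component :: "('v \<Rightarrow> int) \<Rightarrow> ('v, 'k::field) mpoly set" where
  "graded_component a =
     {f. \<forall>t\<in>Poly_Mapping.keys f. \<forall>v. int (Poly_Mapping.lookup t v) = a v}"

definition homogeneous :: "('v, 'k::field) mpoly \<Rightarrow> bool" where
  "homogeneous f \<longleftrightarrow> (\<exists>a. f \<in> graded_component a)"

definition basis_over :: "'a::comm_ring_1 set \<Rightarrow> 'a set \<Rightarrow> 'a set \<Rightarrow> bool" where
  "basis_over R B N \<longleftrightarrow>
     B \<subseteq> N \<and>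
     (\<forall>x\<in>N. \<exists>!c :: 'a \<Rightarrow>\<^sub>0 'a.
        Poly_Mapping.keys c \<subseteq> B \<and> range (Poly_Mapping.lookup c) \<subseteq> R \<and>
        x = (\<Sum>b\<in>Poly_Mapping.keys c. Poly_Mapping.lookup c b * b))"

definition free_over :: "'a::comm_ring_1 set \<Rightarrow> 'a set \<Rightarrow> bool" where
  "free_over R N \<longleftrightarrow> (\<exists>B. basis_over R B N)"

definition stanley_space :: "('v, 'k::field) mpoly \<Rightarrow> 'v set \<Rightarrow> ('v, 'k) mpoly set" where
  "stanley_space u Z = {f * u | f. f \<in> polys_in Z}"

definition internal_direct_sum :: "'a::ab_group_add set \<Rightarrow> nat \<Rightarrow> (nat \<Rightarrow> 'a set) \<Rightarrow> bool" where
  "internal_direct_sum M r V \<longleftrightarrow>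
     (\<forall>i<r. V i \<subseteq> M) \<and>
     (\<forall>x\<in>M. \<exists>!w. w \<in> (\<Pi>\<^sub>E i\<in>{..<r}. V i) \<and> x = (\<Sum>i<r. w i))"

text \<open>
  A summand with \<open>u i = 0\<close> is not excluded, the zero module being free of rank \<open>0\<close>. Deleting
  such summands leaves a Stanley decomposition, so they do not affect the minimal length.
\<close>

definition stanley_decomposition ::
    "('v, 'k::field) mpoly set \<Rightarrow> nat \<Rightarrow> (nat \<Rightarrow> ('v, 'k) mpoly) \<Rightarrow> (nat \<Rightarrow> 'v set) \<Rightarrow> bool" where
  "stanley_decomposition M r u Z \<longleftrightarrow>
     (\<forall>i<r. u i \<in> M \<and> homogeneous (u i) \<and>
            free_over (polys_in (Z i)) (stanley_space (u i) (Z i))) \<and>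
     internal_direct_sum M r (\<lambda>i. stanley_space (u i) (Z i))"

text \<open>
  The infimum in \<^typ>\<open>enat\<close> of a nonempty set of natural numbers is its minimum; a set without
  Stanley decompositions gets length \<open>\<infinity>\<close>.
\<close>

definition slength :: "('v, 'k::field) mpoly set \<Rightarrow> enat" where
  "slength M = Inf {enat r | r. \<exists>u Z. stanley_decomposition M r u Z}"

end

theory Submission
  imports Defs
begin

text \<open>
  Every minimal generator must head a summand of a Stanley decomposition, so in one of length
  \<open>m\<close> the summands are exactly \<open>u K[Z\<^sub>u]\<close> with \<open>u\<close> running through the minimal generators.
  Exactly one generator \<open>c\<close> has \<open>Z\<^sub>c = {x, y}\<close>: two such summands would meet in a common
  multiple, and summands of lower dimension cannot cover \<open>I\<close>. A column of exponents of \<open>I\<close> to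
  the left of \<open>c\<close> is infinite, hence contains a summand \<open>u K[y]\<close> and so a generator;
  symmetrically for the rows below \<open>c\<close>. Listing first \<open>c\<close>, then the generators to its left from
  right to left, then the generators below it from top to bottom, every colon ideal is therefore
  \<open>(x)\<close> or \<open>(y)\<close>.
\<close>

subsection \<open>Ideals generated by monomials\<close>

lemma inj_monomial: "inj (monomial :: _ \<Rightarrow> ('v, 'k::field) mpoly)"
proof (rule injI)
  fix s t :: "'v \<Rightarrow>\<^sub>0 nat"
  assume "(monomial s :: ('v, 'k) mpoly) = monomial t"
  then have "Poly_Mapping.keys (monomial s :: ('v, 'k) mpoly) = Poly_Mapping.keys (monomial t :: ('v, 'k) mpoly)"
    by simp
  then show "s = t" by (simp add: monomial_def)
qed

lemma exponent_diff_add: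
  fixes a t :: "'v \<Rightarrow>\<^sub>0 nat"
  assumes "Poly_Mapping.lookup a \<le> Poly_Mapping.lookup t"
  shows "(t - a) + a = t"
  using assms by (intro poly_mapping_eqI) (simp add: le_fun_def lookup_add lookup_minus)

text \<open>Divisibility of monomials is the pointwise order on exponents. The right-hand side is
  closed under the ideal operations, and every term of one of its elements is a multiple of a
  generator. From here on, ideals are handled through sets of exponents.\<close>

lemma ideal_generated_by_monomials:
  "ideal_generated_by (monomial ` A :: ('v, 'k::field) mpoly set) =
     {f. \<forall>t\<in>Poly_Mapping.keys f. \<exists>a\<in>A. Poly_Mapping.lookup a \<le> Poly_Mapping.lookup t}"
    (is "_ = ?R")
proof
  show "ideal_generated_by (monomial ` A) \<subseteq> ?R"
  proof (rule ideal.span_minimal)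
    show "monomial ` A \<subseteq> ?R" by (auto simp: monomial_def)
    show "ideal.subspace ?R"
    proof (rule ideal.subspaceI)
      fix f g :: "('v, 'k) mpoly"
      assume "f \<in> ?R" "g \<in> ?R"
      then show "f + g \<in> ?R" using Poly_Mapping.keys_add[of f g] by blast
    next
      fix f g :: "('v, 'k) mpoly"
      assume g: "g \<in> ?R"
      show "f * g \<in> ?R"
      proof clarify
        fix t assume "t \<in> Poly_Mapping.keys (f * g)"
        then obtain r s where t: "t = r + s" and s: "s \<in> Poly_Mapping.keys g"
          using keys_mult[of f g] by blast
        obtain a where "a \<in> A" "Poly_Mapping.lookup a \<le> Poly_Mapping.lookup s"
          using g s by blast
        then show "\<exists>a\<in>A. Poly_Mapping.lookup a \<le> Poly_Mapping.lookup t"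
          unfolding t by (auto simp: le_fun_def lookup_add intro!: bexI[of _ a] trans_le_add2)
      qed
    qed simp
  qed
  show "?R \<subseteq> ideal_generated_by (monomial ` A)"
  proof
    fix f :: "('v, 'k) mpoly"
    assume f: "f \<in> ?R"
    have "Poly_Mapping.single t c \<in> ideal_generated_by (monomial ` A)"
      if t: "t \<in> Poly_Mapping.keys f" for t and c :: 'k
    proof -
      obtain a where a: "a \<in> A" "Poly_Mapping.lookup a \<le> Poly_Mapping.lookup t"
        using f t by blast
      have "Poly_Mapping.single t c = Poly_Mapping.single (t - a) c * monomial a"
        by (simp add: monomial_def mult_single exponent_diff_add[OF a(2)])
      also have "\<dots> \<in> ideal_generated_by (monomial ` A)"
        by (intro ideal.span_scale ideal.span_base imageI a)
      finally show ?thesis .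
    qed
    then have "(\<Sum>t\<in>Poly_Mapping.keys f. Poly_Mapping.single t (Poly_Mapping.lookup f t))
        \<in> ideal_generated_by (monomial ` A)"
      by (rule ideal.span_sum)
    moreover have "(\<Sum>t\<in>Poly_Mapping.keys f. Poly_Mapping.single t (Poly_Mapping.lookup f t)) = f"
      by (rule poly_mapping_eqI)
        (auto simp: lookup_sum lookup_single when_def in_keys_iff)
    ultimately show "f \<in> ideal_generated_by (monomial ` A)" by simp
  qed
qed

lemma monomial_in_ideal_iff:
  "(monomial t :: ('v, 'k::field) mpoly) \<in> ideal_generated_by (monomial ` A) \<longleftrightarrow>
     (\<exists>a\<in>A. Poly_Mapping.lookup a \<le> Poly_Mapping.lookup t)"
  unfolding ideal_generated_by_monomials by (simp add: monomial_def)

text \<open>A generator properly divisible by another could be deleted without changing the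
  ideal.\<close>

lemma minimal_monomial_generators_antichain:
  fixes A :: "('v \<Rightarrow>\<^sub>0 nat) set"
  assumes min: "minimal_monomial_generators I (monomial ` A :: ('v, 'k::field) mpoly set)"
    and a: "a \<in> A" and b: "b \<in> A" and le: "Poly_Mapping.lookup a \<le> Poly_Mapping.lookup b"
  shows "a = b"
proof (rule ccontr)
  assume ne: "a \<noteq> b"
  have "(monomial ` (A - {b}) :: ('v, 'k) mpoly set) \<subset> monomial ` A"
    using b inj_monomial[where ?'k = 'k] by (intro image_strict_mono) (auto intro: inj_on_subset)
  moreover have "ideal_generated_by (monomial ` (A - {b}) :: ('v, 'k) mpoly set)
      = ideal_generated_by (monomial ` A)"
    unfolding ideal_generated_by_monomials using a ne le
    by (blast intro: order_trans)
  ultimately show False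
    using min unfolding minimal_monomial_generators_def by metis
qed

text \<open>Multiplication by a monomial shifts the support injectively, so nothing cancels.\<close>

lemma times_monomial_keys:
  fixes f :: "('v, 'k::field) mpoly"
  shows "t \<in> Poly_Mapping.keys f \<Longrightarrow> t + a \<in> Poly_Mapping.keys (f * monomial a)"
proof -
  \<comment> \<open>The convolution sum runs over all splittings \<open>l + q\<close> of
    \<open>t + a\<close>; the factor \<open>monomial a\<close> forces \<open>q = a\<close>, hence
    \<open>l = t\<close>.\<close>
  have "(Poly_Mapping.lookup (monomial a :: ('v, 'k) mpoly) q when t + a = l + q) = ((1 when l = t) when q = a)"
    for l q by (auto simp: monomial_def lookup_single when_def)
  then have "Poly_Mapping.lookup (f * monomial a) (t + a) = (\<Sum>l. Poly_Mapping.lookup f l when l = t)"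
    unfolding lookup_mult by (simp add: mult_when)
  then show "t \<in> Poly_Mapping.keys f \<Longrightarrow> t + a \<in> Poly_Mapping.keys (f * monomial a)"
    by (simp add: in_keys_iff)
qed

text \<open>The colon ideal is generated by the monomials \<open>b / gcd(b, g)\<close>. By
  \<open>larger\<close> each of them is divisible by the variable \<open>v\<close>, and for
  \<open>b = h\<close> the quotient is that variable itself.\<close>

lemma colon_monomials_eq_var:
  fixes B :: "('v \<Rightarrow>\<^sub>0 nat) set" and g h :: "'v \<Rightarrow>\<^sub>0 nat"
  assumes larger: "\<And>b. b \<in> B \<Longrightarrow> Poly_Mapping.lookup g v < Poly_Mapping.lookup b v"
    and h: "h \<in> B" "Poly_Mapping.lookup h v = Suc (Poly_Mapping.lookup g v)"
    and le: "\<And>w. w \<noteq> v \<Longrightarrow> Poly_Mapping.lookup h w \<le> Poly_Mapping.lookup g w"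
  shows "colon (ideal_generated_by (monomial ` B)) (monomial g :: ('v, 'k::field) mpoly)
    = ideal_generated_by (var ` {v})"
proof -
  have var: "var ` {v} = (monomial ` {Poly_Mapping.single v 1} :: ('v, 'k) mpoly set)"
    by (simp add: var_def)
  show ?thesis
  proof (rule set_eqI)
    fix f :: "('v, 'k) mpoly"
    have "f \<in> colon (ideal_generated_by (monomial ` B)) (monomial g) \<longleftrightarrow>
      (\<forall>t\<in>Poly_Mapping.keys f. \<exists>b\<in>B. Poly_Mapping.lookup b \<le> Poly_Mapping.lookup (t + g))"
      (is "?l \<longleftrightarrow> ?r")
    proof
      assume ?l
      then show ?r
        unfolding colon_def ideal_generated_by_monomials using times_monomial_keys[of _ f g] by blast
    next
      assume ?r
      then show ?l
        unfolding colon_def ideal_generated_by_monomials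
        using keys_mult[of f "monomial g"] by (auto simp: monomial_def split: if_splits)
    qed
    also have "\<dots> \<longleftrightarrow> (\<forall>t\<in>Poly_Mapping.keys f. 0 < Poly_Mapping.lookup t v)"
    proof (intro ball_cong refl iffI)
      fix t :: "'v \<Rightarrow>\<^sub>0 nat"
      assume "\<exists>b\<in>B. Poly_Mapping.lookup b \<le> Poly_Mapping.lookup (t + g)"
      then obtain b where "b \<in> B" "Poly_Mapping.lookup b v \<le> Poly_Mapping.lookup t v + Poly_Mapping.lookup g v"
        by (auto simp: le_fun_def lookup_add)
      with larger[of b] show "0 < Poly_Mapping.lookup t v" by simp
    next
      fix t :: "'v \<Rightarrow>\<^sub>0 nat"
      assume "0 < Poly_Mapping.lookup t v"
      with h(2) le have "Poly_Mapping.lookup h w \<le> Poly_Mapping.lookup (t + g) w" for w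
        by (cases "w = v") (auto simp: lookup_add intro: trans_le_add2)
      with h(1) show "\<exists>b\<in>B. Poly_Mapping.lookup b \<le> Poly_Mapping.lookup (t + g)"
        by (auto simp: le_fun_def)
    qed
    also have "\<dots> \<longleftrightarrow> f \<in> ideal_generated_by (var ` {v})"
      unfolding var ideal_generated_by_monomials
      by (auto simp: le_fun_def lookup_single when_def Suc_le_eq)
    finally show "f \<in> colon (ideal_generated_by (monomial ` B)) (monomial g)
        \<longleftrightarrow> f \<in> ideal_generated_by (var ` {v})" .
  qed
qed


subsection \<open>Stanley decompositions with as many summands as generators\<close>

lemma slength_eq_enatD:
  assumes "slength M = enat r"
  obtains u Z where "stanley_decomposition M r u Z"
proof -
  let ?S = "{enat r | r. \<exists>u Z. stanley_decomposition M r u Z}"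
  have "?S \<noteq> {}"
    \<comment> \<open>The infimum of the empty set is \<infinity>, which a finite length
      excludes.\<close>
    using assms unfolding slength_def by (metis enat.distinct(1) Inf_empty top_enat_def)
  then have "Inf ?S \<in> ?S"
    by (metis (no_types, lifting) Inf_enat_def LeastI_ex ex_in_conv)
  then show thesis
    using assms that unfolding slength_def by auto
qed

text \<open>In the fine grading the degree determines the whole exponent vector. The zero polynomial
  is included through \<open>c = 0\<close>.\<close>

lemma homogeneous_imp_single:
  fixes f :: "('v, 'k::field) mpoly"
  assumes "homogeneous f"
  obtains t c where "f = Poly_Mapping.single t c"
proof (cases "f = 0")
  case True
  with that[of 0 0] show thesis by simp
next
  case False
  then obtain t where t: "t \<in> Poly_Mapping.keys f" using keys_eq_empty[of f] by blast
  have "s = t" if "s \<in> Poly_Mapping.keys f" for s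
  proof (rule poly_mapping_eqI)
    fix v
    have "int (Poly_Mapping.lookup s v) = int (Poly_Mapping.lookup t v)"
      using assms t that unfolding homogeneous_def graded_component_def by force
    then show "Poly_Mapping.lookup s v = Poly_Mapping.lookup t v" by simp
  qed
  then have "f = Poly_Mapping.single t (Poly_Mapping.lookup f t)"
    by (intro poly_mapping_eqI) (auto simp: lookup_single when_def in_keys_iff)
  then show thesis by (rule that)
qed

lemma keys_stanley_spaceD:
  fixes f :: "('v, 'k::field) mpoly"
  assumes "f \<in> stanley_space (Poly_Mapping.single t c) Z" and "b \<in> Poly_Mapping.keys f"
  shows "c \<noteq> 0" and "Poly_Mapping.lookup t \<le> Poly_Mapping.lookup b"
    and "\<And>v. v \<notin> Z \<Longrightarrow> Poly_Mapping.lookup b v = Poly_Mapping.lookup t v"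
proof -
  obtain h where h: "h \<in> polys_in Z" and f: "f = h * Poly_Mapping.single t c"
    using assms(1) unfolding stanley_space_def by blast
  show c: "c \<noteq> 0" using assms(2) f by auto
  obtain s where s: "s \<in> Poly_Mapping.keys h" and b: "b = s + t"
    using assms(2) keys_mult[of h "Poly_Mapping.single t c"] c unfolding f by auto
  show "Poly_Mapping.lookup t \<le> Poly_Mapping.lookup b"
    by (simp add: b le_fun_def lookup_add)
  show "Poly_Mapping.lookup b v = Poly_Mapping.lookup t v" if "v \<notin> Z" for v
  proof -
    have "v \<notin> Poly_Mapping.keys s"
      using h s that unfolding polys_in_def by blast
    then show ?thesis by (simp add: b lookup_add in_keys_iff)
  qed
qed

lemma monomial_in_stanley_space:
  fixes c :: "'k::field"
  assumes "c \<noteq> 0" and "Poly_Mapping.lookup t \<le> Poly_Mapping.lookup b"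
  shows "monomial b \<in> stanley_space (Poly_Mapping.single t c) UNIV"
  unfolding stanley_space_def
proof (intro CollectI exI conjI)
  show "Poly_Mapping.single (b - t) (inverse c) \<in> polys_in UNIV"
    by (simp add: polys_in_def)
  show "monomial b = Poly_Mapping.single (b - t) (inverse c) * Poly_Mapping.single t c"
    using assms by (simp add: monomial_def mult_single exponent_diff_add)
qed

lemma internal_direct_sum_disjoint:
  assumes sum: "internal_direct_sum M r V" and zero: "\<And>i. i < r \<Longrightarrow> 0 \<in> V i"
    and ij: "i < r" "j < r" and x: "x \<in> V i" "x \<in> V j" "x \<noteq> 0"
  shows "i = j"
proof -
  \<comment> \<open>Placing \<open>x\<close> in coordinate \<open>i\<close> or in coordinate
    \<open>j\<close> gives two decompositions of the same element. The restriction to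
    \<open>{..<r}\<close> makes them extensional, as uniqueness in the dependent product
    requires.\<close>
  define w where "w k = (\<lambda>l\<in>{..<r}. if l = k then x else 0)" for k
  have "w k \<in> (\<Pi>\<^sub>E l\<in>{..<r}. V l) \<and> x = (\<Sum>l<r. w k l)" if "k < r" "x \<in> V k" for k
  proof
    have "(\<Sum>l<r. w k l) = (\<Sum>l<r. if l = k then x else 0)"
      by (rule sum.cong) (simp_all add: w_def)
    then show "x = (\<Sum>l<r. w k l)" using that by simp
  qed (use that zero in \<open>auto simp: w_def\<close>)
  moreover have "x \<in> M"
    using sum ij x unfolding internal_direct_sum_def by blast
  ultimately have "w i = w j"
    using sum ij x unfolding internal_direct_sum_def by metis
  then have "w i i = w j i" by simp
  then show ?thesis using ij x by (auto simp: w_def split: if_splits)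
qed

text \<open>Extracts the combinatorics of the decomposition: \<open>Y a\<close> is the variable set
  of the summand headed by the generator \<open>a\<close>. This makes sense because all generators
  occur among the \<open>card A\<close> heads, so heads and generators correspond
  bijectively.\<close>

lemma stanley_decomposition_covers:
  fixes A :: "('v \<Rightarrow>\<^sub>0 nat) set"
  defines "I \<equiv> ideal_generated_by (monomial ` A :: ('v, 'k::field) mpoly set)"
  assumes min: "minimal_monomial_generators I (monomial ` A)" and fin: "finite A"
    and dec: "stanley_decomposition I (card A) u Z"
  obtains Y where
    "\<And>b. \<exists>a\<in>A. Poly_Mapping.lookup a \<le> Poly_Mapping.lookup b \<Longrightarrow>
       \<exists>a\<in>A. Poly_Mapping.lookup a \<le> Poly_Mapping.lookup b \<and>
             (\<forall>v. v \<notin> Y a \<longrightarrow> Poly_Mapping.lookup b v = Poly_Mapping.lookup a v)"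
    and "\<And>a a'. a \<in> A \<Longrightarrow> a' \<in> A \<Longrightarrow> Y a = UNIV \<Longrightarrow> Y a' = UNIV \<Longrightarrow> a = a'"
proof -
  let ?m = "card A"
  let ?V = "\<lambda>i. stanley_space (u i) (Z i)"
  have "\<exists>t c. u i = Poly_Mapping.single t c" if "i < ?m" for i
    using dec that homogeneous_imp_single unfolding stanley_decomposition_def by metis
  then obtain t c where u: "\<And>i. i < ?m \<Longrightarrow> u i = Poly_Mapping.single (t i) (c i)"
    by metis
  have sum: "internal_direct_sum I ?m ?V"
    using dec unfolding stanley_decomposition_def by blast
  have cover: "\<exists>i<?m. c i \<noteq> 0 \<and> Poly_Mapping.lookup (t i) \<le> Poly_Mapping.lookup b \<and>
      (\<forall>v. v \<notin> Z i \<longrightarrow> Poly_Mapping.lookup b v = Poly_Mapping.lookup (t i) v)"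
    if "\<exists>a\<in>A. Poly_Mapping.lookup a \<le> Poly_Mapping.lookup b" for b
  proof -
    have "monomial b \<in> I"
      using that unfolding I_def monomial_in_ideal_iff .
    then obtain w where w: "w \<in> (\<Pi>\<^sub>E i\<in>{..<?m}. ?V i)" and b: "monomial b = (\<Sum>i<?m. w i)"
      using sum unfolding internal_direct_sum_def by blast
    have "b \<in> Poly_Mapping.keys (\<Sum>i<?m. w i)"
      unfolding b[symmetric] by (simp add: monomial_def)
    \<comment> \<open>An exponent in the support of a sum lies in the support of some
      summand.\<close>
    then obtain i where i: "i < ?m" "b \<in> Poly_Mapping.keys (w i)"
      using keys_sum[of w "{..<?m}"] by blast
    have "w i \<in> stanley_space (Poly_Mapping.single (t i) (c i)) (Z i)"
      using w i(1) u by (auto dest: PiE_mem)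
    from keys_stanley_spaceD[OF this i(2)] i(1) show ?thesis by blast
  qed
  have "A \<subseteq> t ` {i. i < ?m \<and> c i \<noteq> 0}"
  proof
    fix a assume a: "a \<in> A"
    then obtain i where i: "i < ?m" "c i \<noteq> 0" "Poly_Mapping.lookup (t i) \<le> Poly_Mapping.lookup a"
      using cover[of a] by blast
    have "u i \<in> I" using dec i(1) unfolding stanley_decomposition_def by blast
    \<comment> \<open>The head \<open>t i\<close> divides \<open>a\<close>, but lies in the ideal
      and so is itself divisible by some generator \<open>a'\<close>; the antichain property
      squeezes all three together.\<close>
    then obtain a' where a': "a' \<in> A" "Poly_Mapping.lookup a' \<le> Poly_Mapping.lookup (t i)"
      using i(2) unfolding u[OF i(1)] I_def ideal_generated_by_monomials by auto
    with i(3) have "a' = a"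
      using minimal_monomial_generators_antichain[OF min a'(1) a] by (blast intro: order_trans)
    with a'(2) i(3) have "Poly_Mapping.lookup (t i) = Poly_Mapping.lookup a" by simp
    then have "t i = a" by (simp add: poly_mapping_eqI)
    with i show "a \<in> t ` {i. i < ?m \<and> c i \<noteq> 0}" by blast
  qed
  moreover have "{i. i < ?m \<and> c i \<noteq> 0} \<subseteq> {..<?m}" by blast
  ultimately have "A \<subseteq> t ` {..<?m}" by blast
  \<comment> \<open>Counting: the image of \<open>card A\<close> indices contains \<open>A\<close>,
    so it equals \<open>A\<close> and \<open>t\<close> is injective.\<close>
  then have tA: "t ` {..<?m} = A"
    by (metis card_image_le card_lessThan card_seteq finite_imageI finite_lessThan)
  then have bij: "bij_betw t {..<?m} A"
    by (simp add: bij_betw_def eq_card_imp_inj_on)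
  \<comment> \<open>The generator \<open>t i\<close> is the head of some summand with nonzero
    coefficient; by injectivity that summand has index \<open>i\<close>.\<close>
  have c: "c i \<noteq> 0" if "i < ?m" for i
    using \<open>A \<subseteq> t ` {i. i < ?m \<and> c i \<noteq> 0}\<close> bij that
    by (smt (verit) bij_betw_def image_iff inj_onD lessThan_iff mem_Collect_eq subset_iff image_eqI)
  define inv where "inv = inv_into {..<?m} t"
  have inv: "inv (t i) = i" if "i < ?m" for i
    using bij that unfolding inv_def by (simp add: bij_betw_inv_into_left)
  show thesis
  proof (rule that[of "\<lambda>a. Z (inv a)"])
    fix b assume "\<exists>a\<in>A. Poly_Mapping.lookup a \<le> Poly_Mapping.lookup b"
    from cover[OF this] show "\<exists>a\<in>A. Poly_Mapping.lookup a \<le> Poly_Mapping.lookup b \<and>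
        (\<forall>v. v \<notin> Z (inv a) \<longrightarrow> Poly_Mapping.lookup b v = Poly_Mapping.lookup a v)"
      using inv tA by (metis imageI lessThan_iff)
  next
    fix a a' assume "a \<in> A" "a' \<in> A" and Z: "Z (inv a) = UNIV" "Z (inv a') = UNIV"
    then obtain i j where i: "i < ?m" "a = t i" and j: "j < ?m" "a' = t j"
      using tA by (metis imageE lessThan_iff)
    \<comment> \<open>A common multiple of both heads lies in both full summands, contradicting
      directness unless the indices agree.\<close>
    let ?x = "monomial (t i + t j) :: ('v, 'k) mpoly"
    have "i = j"
    proof (rule internal_direct_sum_disjoint[OF sum _ i(1) j(1)])
      show "0 \<in> ?V k" for k
        by (auto simp: stanley_space_def polys_in_def intro!: exI[of _ 0])
      show "?x \<in> ?V i" "?x \<in> ?V j"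
        using Z i j c inv u by (auto simp: le_fun_def lookup_add intro!: monomial_in_stanley_space)
      show "?x \<noteq> 0"
        by (simp add: monomial_def flip: keys_eq_empty)
    qed
    then show "a = a'" using i j by simp
  qed
qed


subsection \<open>Generators in every column before the full summand\<close>

lemma ex_exponent:
  fixes f :: "'v::finite \<Rightarrow> nat"
  obtains b :: "'v \<Rightarrow>\<^sub>0 nat" where "Poly_Mapping.lookup b = f"
  by (metis finite lookup_Abs_poly_mapping)

text \<open>Works in any finite number of variables: points far out in the remaining directions can
  only be covered by summands that are free in those directions.\<close>

lemma full_summand_consecutive:
  fixes A :: "('v::finite \<Rightarrow>\<^sub>0 nat) set"
  assumes fin: "finite A" and ne: "A \<noteq> {}"
    and cover: "\<And>b. \<exists>a\<in>A. Poly_Mapping.lookup a \<le> Poly_Mapping.lookup b \<Longrightarrow>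
       \<exists>a\<in>A. Poly_Mapping.lookup a \<le> Poly_Mapping.lookup b \<and>
             (\<forall>v. v \<notin> Y a \<longrightarrow> Poly_Mapping.lookup b v = Poly_Mapping.lookup a v)"
    and unique: "\<And>a a'. a \<in> A \<Longrightarrow> a' \<in> A \<Longrightarrow> Y a = UNIV \<Longrightarrow> Y a' = UNIV \<Longrightarrow> a = a'"
  obtains c where "c \<in> A"
    and "\<And>g v p. g \<in> A \<Longrightarrow> Poly_Mapping.lookup g v \<le> p \<Longrightarrow> p < Poly_Mapping.lookup c v \<Longrightarrow>
           \<exists>h\<in>A. Poly_Mapping.lookup h v = p"
proof -
  have "finite (\<Union>a\<in>A. range (Poly_Mapping.lookup a))"
    using fin by simp
  then obtain N where "\<forall>n\<in>(\<Union>a\<in>A. range (Poly_Mapping.lookup a)). n < N"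
    using finite_nat_set_iff_bounded by blast
  then have N: "Poly_Mapping.lookup a v < N" if "a \<in> A" for a v
    using that by blast
  \<comment> \<open>This point exceeds every generator in each coordinate, so the summand covering
    it must be full; its head is the desired \<open>c\<close>.\<close>
  obtain b :: "'v \<Rightarrow>\<^sub>0 nat" where b: "Poly_Mapping.lookup b = (\<lambda>_. N)"
    by (rule ex_exponent)
  obtain c where c: "c \<in> A" "\<forall>v. v \<notin> Y c \<longrightarrow> N = Poly_Mapping.lookup c v"
    using cover[of b] ne N unfolding b le_fun_def by (metis ex_in_conv less_imp_le)
  have full: "Y c = UNIV"
    using c N[OF c(1)] by (metis UNIV_eq_I less_irrefl)
  show thesis
  proof (rule that[OF c(1)])
    fix g v p
    assume g: "g \<in> A" and p: "Poly_Mapping.lookup g v \<le> p" "p < Poly_Mapping.lookup c v"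
    \<comment> \<open>A far point of the slice where the \<open>v\<close>-exponent is
      \<open>p\<close>. Its covering summand is free in all other variables; were it also free in
      \<open>v\<close>, it would be headed by \<open>c\<close>, whose \<open>v\<close>-exponent
      exceeds \<open>p\<close>. Hence its head lies in the slice.\<close>
    obtain d :: "'v \<Rightarrow>\<^sub>0 nat" where d: "Poly_Mapping.lookup d = (\<lambda>w. if w = v then p else N)"
      by (rule ex_exponent)
    have "Poly_Mapping.lookup g \<le> Poly_Mapping.lookup d"
      using N[OF g] p by (simp add: d le_fun_def less_imp_le)
    then obtain h where h: "h \<in> A" "Poly_Mapping.lookup h \<le> Poly_Mapping.lookup d"
      "\<forall>w. w \<notin> Y h \<longrightarrow> Poly_Mapping.lookup d w = Poly_Mapping.lookup h w"
      using cover[of d] g by blast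
    have "v \<notin> Y h"
    proof
      assume "v \<in> Y h"
      moreover have "w \<in> Y h" if "w \<noteq> v" for w
        using h(3) N[OF h(1), of w] that by (auto simp: d)
      ultimately have "Y h = UNIV" by (metis UNIV_eq_I)
      with unique full h(1) c(1) have "h = c" by blast
      with h(2) p show False
        by (auto simp: d le_fun_def split: if_splits dest: spec[of _ v])
    qed
    with h(3) have "Poly_Mapping.lookup h v = Poly_Mapping.lookup d v" by simp
    with h(1) show "\<exists>h\<in>A. Poly_Mapping.lookup h v = p" by (auto simp: d)
  qed
qed


subsection \<open>The ordering with linear quotients\<close>

text \<open>Turns the predecessors in a list into a set described by \<open>key\<close>, so that
  colon ideals can be computed without list positions.\<close>

lemma finite_set_list_by_key:
  fixes key :: "'a \<Rightarrow> 'b::linorder"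
  assumes "finite A" and "inj_on key A"
  obtains xs where "set xs = A" "distinct xs"
    "\<And>j. j < length xs \<Longrightarrow> set (take j xs) = {a \<in> A. key a < key (xs ! j)}"
proof -
  obtain ys where ys: "set ys = A" "distinct ys"
    using finite_distinct_list[OF assms(1)] by blast
  define xs where "xs = sort_key key ys"
  have xs: "set xs = A" "distinct xs" "sorted (map key xs)"
    using ys by (simp_all add: xs_def)
  then have "sorted_wrt (<) (map key xs)"
    using assms(2) by (simp add: strict_sorted_iff distinct_map)
  then have less: "key (xs ! i) < key (xs ! j) \<longleftrightarrow> i < j" if "i < length xs" "j < length xs" for i j
    using that by (metis length_map not_less_iff_gr_or_eq nth_map sorted_wrt_nth_less)
  show thesis
  proof (rule that[OF xs(1,2)])
    fix j assume j: "j < length xs"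
    have "set (take j xs) = {xs ! i | i. i < j}"
      using nth_image[of j xs] j by (force simp: image_def)
    also have "\<dots> = {a \<in> A. key a < key (xs ! j)}"
      using less j unfolding xs(1)[symmetric] set_conv_nth by (auto intro: less_trans)
    finally show "set (take j xs) = {a \<in> A. key a < key (xs ! j)}" .
  qed
qed

text \<open>Consecutiveness supplies, for each generator other than \<open>c\<close>, a neighbour
  one exponent step closer to \<open>c\<close>; this is the \<open>h\<close> required by
  \<open>colon_monomials_eq_var\<close>.\<close>

lemma linear_quotients_if_consecutive:
  fixes A :: "('v \<Rightarrow>\<^sub>0 nat) set" and I :: "('v, 'k::field) mpoly set" and x y :: 'v
  assumes xy: "x \<noteq> y" "UNIV = {x, y}"
    and min: "minimal_monomial_generators I (monomial ` A)" and fin: "finite A" and c: "c \<in> A"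
    and consec: "\<And>g v p. g \<in> A \<Longrightarrow> Poly_Mapping.lookup g v \<le> p \<Longrightarrow>
      p < Poly_Mapping.lookup c v \<Longrightarrow> \<exists>h\<in>A. Poly_Mapping.lookup h v = p"
  shows "linear_quotients I"
proof -
  let ?X = "\<lambda>a. Poly_Mapping.lookup a x" and ?Y = "\<lambda>a. Poly_Mapping.lookup a y"
  have all: "P x \<Longrightarrow> P y \<Longrightarrow> P v" for P v
    using xy(2) by (metis UNIV_I empty_iff insert_iff)
  have anti: "a = b" if "a \<in> A" "b \<in> A" "?X a \<le> ?X b" "?Y a \<le> ?Y b" for a b
    using minimal_monomial_generators_antichain[OF min that(1,2)] that(3,4)
      all[of "\<lambda>v. Poly_Mapping.lookup a v \<le> Poly_Mapping.lookup b v"] by (auto simp: le_fun_def)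
  \<comment> \<open>The generator \<open>c\<close> gets key 0. Generators to its left get at most
    \<open>?X c\<close>; those to its right lie strictly below \<open>c\<close>, so the offset
    \<open>?X c\<close> puts them after all the others and the subtraction is not truncated.\<close>
  define key where "key a = (if ?X a \<le> ?X c then ?X c - ?X a else ?X c + (?Y c - ?Y a))" for a
  have below: "?Y a < ?Y c" if "a \<in> A" "?X c < ?X a" for a
    using anti[OF c that(1)] that(2) by force
  have "inj_on key A"
  proof (rule inj_onI)
    fix a b assume ab: "a \<in> A" "b \<in> A" "key a = key b"
    then have "?X a = ?X b \<or> ?Y a = ?Y b"
      using below[of a] below[of b] by (auto simp: key_def split: if_splits)
    then show "a = b"
      using anti[OF ab(1,2)] anti[OF ab(2,1)] by (metis nat_le_linear order_refl)
  qed
  then obtain as where as: "set as = A" "distinct as"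
    "\<And>j. j < length as \<Longrightarrow> set (take j as) = {a \<in> A. key a < key (as ! j)}"
    using finite_set_list_by_key[OF fin] by blast
  have quot: "\<exists>v. colon (ideal_generated_by (monomial ` {a \<in> A. key a < key g}))
        (monomial g :: ('v, 'k) mpoly) = ideal_generated_by (var ` {v})"
    if g: "g \<in> A" "g \<noteq> c" for g
  proof (cases "?X g < ?X c")
    case True
    have "\<exists>h\<in>A. ?X h = Suc (?X g)"
    proof (cases "Suc (?X g) = ?X c")
      case False
      with True consec[OF g(1), of x "Suc (?X g)"] show ?thesis by simp
    qed (use c in auto)
    then obtain h where h: "h \<in> A" "?X h = Suc (?X g)" by blast
    \<comment> \<open>Otherwise \<open>g\<close> would properly divide \<open>h\<close>.\<close>
    have "?Y h \<le> ?Y g"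
      using anti[OF g(1) h(1)] h(2) by force
    then have le: "Poly_Mapping.lookup h w \<le> Poly_Mapping.lookup g w" if "w \<noteq> x" for w
      using that all[of "\<lambda>w. w \<noteq> x \<longrightarrow> Poly_Mapping.lookup h w \<le> Poly_Mapping.lookup g w"] by blast
    have "?X g < ?X b" if "key b < key g" for b
      using that True by (auto simp: key_def split: if_splits)
    moreover have "key h < key g"
      using True h(2) by (simp add: key_def)
    ultimately show ?thesis
      using colon_monomials_eq_var[of "{a \<in> A. key a < key g}" g x h] h le by blast
  next
    case False
    \<comment> \<open>With equal \<open>x\<close>-exponents, \<open>g\<close> and \<open>c\<close>
      would be comparable.\<close>
    with g have X: "?X c < ?X g"
      using anti[OF g(1) c] anti[OF c g(1)] by (metis linorder_neqE_nat nat_le_linear order_refl)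
    have Y: "?Y g < ?Y c" by (rule below[OF g(1) X])
    have "\<exists>h\<in>A. ?Y h = Suc (?Y g)"
    proof (cases "Suc (?Y g) = ?Y c")
      case False
      with Y consec[OF g(1), of y "Suc (?Y g)"] show ?thesis by simp
    qed (use c in auto)
    then obtain h where h: "h \<in> A" "?Y h = Suc (?Y g)" by blast
    have "?X h \<le> ?X g"
      using anti[OF g(1) h(1)] h(2) by force
    then have le: "Poly_Mapping.lookup h w \<le> Poly_Mapping.lookup g w" if "w \<noteq> y" for w
      using that all[of "\<lambda>w. w \<noteq> y \<longrightarrow> Poly_Mapping.lookup h w \<le> Poly_Mapping.lookup g w"] by blast
    \<comment> \<open>A predecessor in a column up to that of \<open>c\<close> has smaller
      \<open>x\<close>-exponent than \<open>g\<close>, hence larger \<open>y\<close>-exponent by the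
      antichain property; for the others the keys compare the \<open>y\<close>-exponents
      directly.\<close>
    have "?Y g < ?Y b" if "b \<in> A" "key b < key g" for b
    proof (cases "?X b \<le> ?X c")
      case True
      then show ?thesis using anti[OF that(1) g(1)] X by force
    next
      case False
      then show ?thesis using that X by (auto simp: key_def split: if_splits)
    qed
    moreover have "key h < key g"
      using X Y h(2) by (auto simp: key_def)
    ultimately show ?thesis
      using colon_monomials_eq_var[of "{a \<in> A. key a < key g}" g y h] h le by blast
  qed
  show ?thesis
    unfolding linear_quotients_def
  proof (rule exI[of _ "map monomial as"], intro conjI allI impI)
    show "distinct (map monomial as :: ('v, 'k) mpoly list)"
      using as(2) inj_monomial by (auto simp: distinct_map intro: inj_on_subset)
    show "minimal_monomial_generators I (set (map monomial as))"
      using min as(1) by simp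
    fix j assume j: "1 \<le> j \<and> j < length (map monomial as :: ('v, 'k) mpoly list)"
    \<comment> \<open>Having a predecessor means having a positive key, so the entry is not
      \<open>c\<close>.\<close>
    then have "as ! 0 \<in> set (take j as)"
      by (auto simp: in_set_conv_nth intro!: exI[of _ 0])
    then have "key (as ! j) \<noteq> 0"
      using as(3) j by auto
    then have "as ! j \<noteq> c" by (auto simp: key_def)
    moreover have "as ! j \<in> A" using as(1) j by auto
    ultimately obtain v where "colon (ideal_generated_by (monomial ` set (take j as)))
        (monomial (as ! j) :: ('v, 'k) mpoly) = ideal_generated_by (var ` {v})"
      using quot[of "as ! j"] as(3)[of j] j by auto
    then show "\<exists>Z. colon (ideal_generated_by (set (take j (map monomial as))))
        (map monomial as ! j :: ('v, 'k) mpoly) = ideal_generated_by (var ` Z)"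
      using j by (intro exI[of _ "{v}"]) (simp add: take_map)
  qed
qed

theorem proposition4p3:
  fixes I G :: "(2, 'k::field) mpoly set" and m :: nat
  assumes "monomial_ideal I"
    and "minimal_monomial_generators I G" and "finite G" and "card G = m"
    and "slength I = enat m"
  shows "linear_quotients I"
proof (cases "G = {}")
  case True
  with assms(2) show ?thesis
    unfolding linear_quotients_def by (intro exI[of _ "[]"]) simp
next
  case False
  obtain A where A: "G = monomial ` A"
    using assms(2) unfolding minimal_monomial_generators_def by (metis subset_imageE)
  have inj: "inj_on (monomial :: _ \<Rightarrow> (2, 'k) mpoly) A"
    using inj_monomial by (rule inj_on_subset) simp
  have fin: "finite A" and card: "card A = m"
    using assms(3,4) inj unfolding A by (simp_all add: finite_image_iff card_image)
  have I: "I = ideal_generated_by (monomial ` A)"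
    using assms(2) unfolding minimal_monomial_generators_def A by simp
  have min: "minimal_monomial_generators I (monomial ` A)"
    using assms(2) unfolding A .
  obtain u Z where "stanley_decomposition I (card A) u Z"
    using assms(5) unfolding card[symmetric] by (rule slength_eq_enatD)
  then obtain Y where Y:
    "\<And>b. \<exists>a\<in>A. Poly_Mapping.lookup a \<le> Poly_Mapping.lookup b \<Longrightarrow>
       \<exists>a\<in>A. Poly_Mapping.lookup a \<le> Poly_Mapping.lookup b \<and>
             (\<forall>v. v \<notin> Y a \<longrightarrow> Poly_Mapping.lookup b v = Poly_Mapping.lookup a v)"
    "\<And>a a'. a \<in> A \<Longrightarrow> a' \<in> A \<Longrightarrow> Y a = UNIV \<Longrightarrow> Y a' = UNIV \<Longrightarrow> a = a'"
    using stanley_decomposition_covers[OF min[unfolded I] fin] unfolding I by metis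
  obtain c where c: "c \<in> A"
    "\<And>g v p. g \<in> A \<Longrightarrow> Poly_Mapping.lookup g v \<le> p \<Longrightarrow> p < Poly_Mapping.lookup c v \<Longrightarrow>
       \<exists>h\<in>A. Poly_Mapping.lookup h v = p"
    using full_summand_consecutive[OF fin _ Y] False A by blast
  \<comment> \<open>The elements 0 and 1 of the index type serve as \<open>x\<close> and
    \<open>y\<close>.\<close>
  have "(UNIV :: 2 set) = {0, 1}"
  proof (rule card_subset_eq[symmetric])
    show "card {0, 1 :: 2} = card (UNIV :: 2 set)" by simp
  qed simp_all
  then show ?thesis
    by (rule linear_quotients_if_consecutive[OF zero_neq_one _ min fin c])
qed

end
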